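(* Let $\mathbb{F}$ be a field and let $\alpha,\beta\in\mathbb{F}$ with $1,\alpha,\beta$ pairwise distinct. Let $A$ be a $2$-dimensional $\mathcal{J}(\alpha,\beta)$-axial algebra over $\mathbb{F}$ satisfying the $(\star)$ condition that is generated by primitive axes $a$ and $b$. Write $b=\delta a+b_\alpha+b_\beta$ with $\delta\in\mathbb{F}$, $b_\alpha\in A_\alpha(a)$, $b_\beta\in A_\beta(a)$. Then one of the following is true: - $ab=\alpha(a+b)$; here $\delta=\frac{-\alpha}{\alpha-1}$; - $ab=\beta(a+b)$ and $\beta=-1$ or $\beta=\frac12$; here $\delta=\frac{-\beta}{\beta-1}$.
   Context: Algebras are commutative but not necessarily associative. For an element $a$ of an $\mathbb{F}$-algebra $A$ and $\lambda\in\mathbb{F}$, $A_\lambda(a)=\{x\in A: ax=\lambda x\}$ (possibly zero). $\langle\ldots\rangle$ denotes linear span. A $\mathcal{J}(\alpha,\beta)$-axis is a nonzero idempotent $a\in A$ such that $A=A_1(a)\oplus A_\alpha(a)\oplus A_\beta(a)$ and the fusion law holds: $A_1(a)A_\lambda(a)\subseteq A_\lambda(a)$ for $\lambda\in\{1,\alpha,\beta\}$, $A_\alpha(a)A_\alpha(a)\subseteq A_1(a)\oplus A_\alpha(a)$, $A_\alpha(a)A_\beta(a)\subseteq A_\beta(a)$, $A_\beta(a)A_\beta(a)\subseteq A_1(a)\oplus A_\alpha(a)$. "Axis" means $\mathcal{J}(\alpha,\beta)$-axis. An axis $a$ is primitive if $A_1(a)=\langle a\rangle$. A $\mathcal{J}(\alpha,\beta)$-axial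 algebra is a commutative algebra generated (as an algebra) by a set of $\mathcal{J}(\alpha,\beta)$-axes. Condition $(\star)$: for any two primitive axes $a,b\in A$, if $b=\delta a+b_\alpha+b_\beta$ with $\delta\in\mathbb{F}$, $b_\alpha\in A_\alpha(a)$, $b_\beta\in A_\beta(a)$, then the projection of $a$ onto $A_1(b)$ (along $A_\alpha(b)\oplus A_\beta(b)$) equals $\delta b$. *)

theory Defs
  imports Complex_Main "HOL-Library.Set_Algebras"
begin

text \<open>The algebra is the whole type \<open>'v\<close>. The product is not assumed to be associative or
  unital.\<close>

locale comm_algebra = vector_space scale
  for scale :: "'f::field \<Rightarrow> 'v::ab_group_add \<Rightarrow> 'v" (infixr \<open>*s\<close> 75) +
  fixes mult :: "'v \<Rightarrow> 'v \<Rightarrow> 'v" (infixl \<open>\<cdot>\<close> 70)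
  assumes mult_commute: "x \<cdot> y = y \<cdot> x"
    and mult_add_left: "(x + y) \<cdot> z = x \<cdot> z + y \<cdot> z"
    and mult_scale_left: "(c *s x) \<cdot> y = c *s (x \<cdot> y)"
begin

definition subalgebra :: "'v set \<Rightarrow> bool" where
  "subalgebra S \<longleftrightarrow> subspace S \<and> (\<forall>x\<in>S. \<forall>y\<in>S. x \<cdot> y \<in> S)"

definition generated :: "'v set \<Rightarrow> 'v set" where
  "generated X = subalgebra hull X"

definition eigenspace :: "'f \<Rightarrow> 'v \<Rightarrow> 'v set" where
  "eigenspace l a = {x. a \<cdot> x = l *s x}"

text \<open>Below, \<open>+\<close> between sets is the elementwise (Minkowski) sum; the products of
  eigenspaces in the fusion law are spelled out elementwise.\<close>

definition axis :: "'f \<Rightarrow> 'f \<Rightarrow> 'v \<Rightarrow> bool" where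
  "axis \<alpha> \<beta> a \<longleftrightarrow>
     a \<noteq> 0 \<and> a \<cdot> a = a \<and>
     (\<forall>x. \<exists>!(u, v, w). u \<in> eigenspace 1 a \<and> v \<in> eigenspace \<alpha> a \<and> w \<in> eigenspace \<beta> a
            \<and> x = u + v + w) \<and>
     (\<forall>l\<in>{1, \<alpha>, \<beta>}. \<forall>x\<in>eigenspace 1 a. \<forall>y\<in>eigenspace l a. x \<cdot> y \<in> eigenspace l a) \<and>
     (\<forall>x\<in>eigenspace \<alpha> a. \<forall>y\<in>eigenspace \<alpha> a. x \<cdot> y \<in> eigenspace 1 a + eigenspace \<alpha> a) \<and>
     (\<forall>x\<in>eigenspace \<alpha> a. \<forall>y\<in>eigenspace \<beta> a. x \<cdot> y \<in> eigenspace \<beta> a) \<and>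
     (\<forall>x\<in>eigenspace \<beta> a. \<forall>y\<in>eigenspace \<beta> a. x \<cdot> y \<in> eigenspace 1 a + eigenspace \<alpha> a)"

definition primitive_axis :: "'f \<Rightarrow> 'f \<Rightarrow> 'v \<Rightarrow> bool" where
  "primitive_axis \<alpha> \<beta> a \<longleftrightarrow> axis \<alpha> \<beta> a \<and> eigenspace 1 a = span {a}"

definition axial_algebra :: "'f \<Rightarrow> 'f \<Rightarrow> bool" where
  "axial_algebra \<alpha> \<beta> \<longleftrightarrow> (\<exists>X. (\<forall>x\<in>X. axis \<alpha> \<beta> x) \<and> generated X = UNIV)"

text \<open>The projection onto the \<open>1\<close>-eigenspace of \<open>b\<close> along the sum of the \<open>\<alpha>\<close>- and
  \<open>\<beta>\<close>-eigenspaces; only meaningful when \<open>b\<close> is an axis, so that the decomposition exists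
  and is unique.\<close>

definition proj1 :: "'f \<Rightarrow> 'f \<Rightarrow> 'v \<Rightarrow> 'v \<Rightarrow> 'v" where
  "proj1 \<alpha> \<beta> b x =
     (THE u. u \<in> eigenspace 1 b \<and>
        (\<exists>v\<in>eigenspace \<alpha> b. \<exists>w\<in>eigenspace \<beta> b. x = u + v + w))"

definition star_condition :: "'f \<Rightarrow> 'f \<Rightarrow> bool" where
  "star_condition \<alpha> \<beta> \<longleftrightarrow>
     (\<forall>a b \<delta> b\<^sub>\<alpha> b\<^sub>\<beta>.
        primitive_axis \<alpha> \<beta> a \<longrightarrow> primitive_axis \<alpha> \<beta> b \<longrightarrow>
        b\<^sub>\<alpha> \<in> eigenspace \<alpha> a \<longrightarrow> b\<^sub>\<beta> \<in> eigenspace \<beta> a \<longrightarrow>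
        b = \<delta> *s a + b\<^sub>\<alpha> + b\<^sub>\<beta> \<longrightarrow>
        proj1 \<alpha> \<beta> b a = \<delta> *s b)"

end

end

theory Submission imports Defs begin

text \<open>In dimension 2 a primitive axis \<open>a\<close> has only one nonzero eigenspace besides
  \<open>A\<^sub>1(a)\<close>, so \<open>b - \<delta> a\<close> is an eigenvector of \<open>a\<close> for some \<open>\<gamma> \<in> {\<alpha>, \<beta>}\<close>; by the
  \<open>\<star>\<close>-condition \<open>a - \<delta> b\<close> is likewise an eigenvector of \<open>b\<close> for some \<open>\<gamma>' \<in> {\<alpha>, \<beta>}\<close>.
  Computing \<open>a b\<close> in both ways yields \<open>\<gamma> = \<delta> (1 - \<gamma>')\<close> and \<open>\<gamma>' = \<delta> (1 - \<gamma>)\<close>. Whenever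
  \<open>\<beta>\<close> is one of the two eigenvalues, the idempotency of the other axis and the fusion law
  \<open>A\<^sub>\<beta> A\<^sub>\<beta> \<subseteq> A\<^sub>1 \<oplus> A\<^sub>\<alpha>\<close> force \<open>2 \<delta> \<beta> = 1\<close>. If \<open>\<gamma> \<noteq> \<gamma>'\<close>, then \<open>\<delta> = 1\<close> and
  \<open>\<alpha> + \<beta> = 1\<close>, whence \<open>\<alpha> = \<beta>\<close>, a contradiction.\<close>

context comm_algebra
begin

lemma mult_add_right: "x \<cdot> (y + z) = x \<cdot> y + x \<cdot> z"
  using mult_add_left mult_commute by metis

lemma mult_scale_right: "x \<cdot> (c *s y) = c *s (x \<cdot> y)"
  using mult_scale_left mult_commute by metis

lemma eigenspace_iff: "x \<in> eigenspace l a \<longleftrightarrow> a \<cdot> x = l *s x"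
  by (simp add: eigenspace_def)

lemma eigenspace_subspace: "subspace (eigenspace l a)"
proof -
  have "a \<cdot> 0 = 0" using mult_scale_right[of a 0 0] by simp
  then show ?thesis
    by (simp add: subspace_def eigenspace_def mult_add_right mult_scale_right
        scale_right_distrib mult.commute)
qed

lemma axis_decomposition:
  assumes "axis \<alpha> \<beta> a"
  obtains u v w where "u \<in> eigenspace 1 a" "v \<in> eigenspace \<alpha> a" "w \<in> eigenspace \<beta> a"
    "x = u + v + w"
  using assms unfolding axis_def by blast

lemma axis_decomposition_unique:
  assumes "axis \<alpha> \<beta> a"
    and "u \<in> eigenspace 1 a" "v \<in> eigenspace \<alpha> a" "w \<in> eigenspace \<beta> a"
    and "u' \<in> eigenspace 1 a" "v' \<in> eigenspace \<alpha> a" "w' \<in> eigenspace \<beta> a"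
    and "u + v + w = u' + v' + w'"
  shows "u = u'" "v = v'" "w = w'"
proof -
  \<comment> \<open>Packing the components into one triple lets the unique existence in
    \<open>axis\<close> act on a single predicate.\<close>
  define P where "P = (\<lambda>(p, q, r). p \<in> eigenspace 1 a \<and> q \<in> eigenspace \<alpha> a
      \<and> r \<in> eigenspace \<beta> a \<and> u + v + w = p + q + r)"
  have "\<exists>!z. P z"
    using assms(1) unfolding axis_def P_def by (elim conjE allE)
  moreover have "P (u, v, w)" "P (u', v', w')"
    using assms(2-8) by (simp_all add: P_def)
  ultimately have "(u, v, w) = (u', v', w')" by blast
  then show "u = u'" "v = v'" "w = w'" by simp_all
qed

lemma proj1_eq:
  assumes "axis \<alpha> \<beta> a"
    and "u \<in> eigenspace 1 a" "v \<in> eigenspace \<alpha> a" "w \<in> eigenspace \<beta> a"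
  shows "proj1 \<alpha> \<beta> a (u + v + w) = u"
  unfolding proj1_def
  using assms axis_decomposition_unique[OF assms(1)] by (intro the_equality) blast+

text \<open>Uniqueness of the decomposition of 0 makes \<open>a\<close>, \<open>v\<close>,
  \<open>w\<close> independent once \<open>v\<close> and \<open>w\<close> are both nonzero, and a
  plane has no room for three such vectors.\<close>

lemma dim_two_eigenvectors:
  assumes ax: "axis \<alpha> \<beta> a" and dim: "dim (UNIV :: 'v set) = 2"
    and v: "v \<in> eigenspace \<alpha> a" and w: "w \<in> eigenspace \<beta> a"
  shows "v = 0 \<or> w = 0"
proof (rule ccontr)
  assume "\<not> (v = 0 \<or> w = 0)"
  then have nz: "v \<noteq> 0" "w \<noteq> 0" by auto
  have a: "a \<noteq> 0" "a \<in> eigenspace 1 a"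
    using ax by (auto simp: axis_def eigenspace_iff)
  note sub = subspace_scale[OF eigenspace_subspace] subspace_0[OF eigenspace_subspace]
  have zero: "p = 0 \<and> q = 0 \<and> r = 0" if "p *s a + q *s v + r *s w = 0" for p q r
    using axis_decomposition_unique[OF ax, of "p *s a" "q *s v" "r *s w" 0 0 0]
      that a v w nz sub by simp
  have "v \<notin> span {w}"
  proof
    assume "v \<in> span {w}"
    then obtain k where "v = k *s w" by (auto simp: span_singleton)
    then have "0 *s a + 1 *s v + (- k) *s w = 0" by simp
    then show False using zero by fastforce
  qed
  moreover have "a \<notin> span {v, w}"
  proof
    assume "a \<in> span {v, w}"
    then obtain k where "a - k *s v \<in> span {w}" by (auto simp: span_insert)
    then obtain l where "a - k *s v = l *s w" by (auto simp: span_singleton)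
    then have "1 *s a + (- k) *s v + (- l) *s w = 0" by simp
    then show False using zero by fastforce
  qed
  ultimately have "independent {a, v, w}" "card {a, v, w} = 3"
    using nz span_base[of _ "{v, w}"] span_base[of _ "{w}"]
    by (auto simp: independent_insert card_insert_if)
  moreover obtain B where "UNIV \<subseteq> span B" "card B = 2"
    using basis_exists[of UNIV] dim by metis
  \<comment> \<open>An infinite set has cardinality 0 by convention, so \<open>card B = 2\<close>
    excludes it.\<close>
  moreover from this have "finite B" using card.infinite by fastforce
  ultimately show False
    using independent_span_bound[of B "{a, v, w}"] by auto
qed

text \<open>Compare the \<beta>-components of \<open>b \<cdot> b\<close> and \<open>b\<close>: the
  mixed terms contribute \<open>(2 * \<delta> * \<beta>) *s x\<close>, while
  \<open>x \<cdot> x\<close> contributes nothing by the fusion law.\<close>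

lemma beta_eigenvector_coefficient:
  assumes pa: "primitive_axis \<alpha> \<beta> a" and "b \<cdot> b = b"
    and b: "b = \<delta> *s a + x" and x: "x \<in> eigenspace \<beta> a" and "x \<noteq> 0"
  shows "2 * \<delta> * \<beta> = 1"
proof -
  have ax: "axis \<alpha> \<beta> a" using pa by (simp add: primitive_axis_def)
  then have aa: "a \<cdot> a = a" by (simp add: axis_def)
  have "x \<cdot> x \<in> eigenspace 1 a + eigenspace \<alpha> a"
    using ax x unfolding axis_def by blast
  then obtain u v where uv: "x \<cdot> x = u + v" "u \<in> eigenspace 1 a" "v \<in> eigenspace \<alpha> a"
    by (auto elim: set_plus_elim)
  have a: "a \<in> eigenspace 1 a" using aa by (simp add: eigenspace_iff)
  note E = eigenspace_subspace and scale = subspace_scale[OF eigenspace_subspace]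
  have ax': "a \<cdot> x = \<beta> *s x" "x \<cdot> a = \<beta> *s x"
    using x mult_commute by (auto simp: eigenspace_iff)
  have "2 * \<delta> * \<beta> = \<delta> * \<beta> + \<delta> * \<beta>"
    by (simp only: mult_2 distrib_right)
  then have two: "(2 * \<delta> * \<beta>) *s x = (\<delta> * \<beta>) *s x + (\<delta> * \<beta>) *s x"
    using scale_left_distrib by metis
  have "b \<cdot> b = \<delta> *s (\<delta> *s a + \<beta> *s x) + (\<delta> *s \<beta> *s x + (u + v))"
    unfolding b by (simp only: mult_add_left mult_add_right mult_scale_left mult_scale_right
        aa ax' uv(1))
  also have "\<dots> = ((\<delta> * \<delta>) *s a + u) + v + (2 * \<delta> * \<beta>) *s x"
    unfolding two scale_right_distrib scale_scale by (simp only: add_ac)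
  finally have "b \<cdot> b = ((\<delta> * \<delta>) *s a + u) + v + (2 * \<delta> * \<beta>) *s x" .
  then have "((\<delta> * \<delta>) *s a + u) + v + (2 * \<delta> * \<beta>) *s x = \<delta> *s a + 0 + x"
    using assms(2) b by simp
  then have "(2 * \<delta> * \<beta>) *s x = x"
    by (rule axis_decomposition_unique(3)[OF ax subspace_add[OF E scale[OF a] uv(2)] uv(3)
        scale[OF x] scale[OF a] subspace_0[OF E] x])
  then have "(2 * \<delta> * \<beta> - 1) *s x = 0" by (simp add: scale_left_diff_distrib)
  then show ?thesis using \<open>x \<noteq> 0\<close> by simp
qed

text \<open>The case \<gamma> = \<alpha> carries no constraint on \<delta>, since the fusion law
  allows the square of an \<alpha>-eigenvector an \<alpha>-component.\<close>

lemma dim_two_product: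
  assumes pa: "primitive_axis \<alpha> \<beta> a" and dim: "dim (UNIV :: 'v set) = 2"
    and bb: "b \<cdot> b = b" and nspan: "b \<notin> span {a}"
    and v: "v \<in> eigenspace \<alpha> a" and w: "w \<in> eigenspace \<beta> a" and b: "b = \<delta> *s a + v + w"
  obtains \<gamma> where "\<gamma> = \<alpha> \<or> \<gamma> = \<beta> \<and> 2 * \<delta> * \<beta> = 1" "a \<cdot> b = (\<delta> * (1 - \<gamma>)) *s a + \<gamma> *s b"
proof -
  have ax: "axis \<alpha> \<beta> a" using pa by (simp add: primitive_axis_def)
  then have aa: "a \<cdot> a = a" by (simp add: axis_def)
  \<comment> \<open>Here \<open>a \<cdot> b = \<delta> *s a + \<gamma> *s x\<close>, and
    \<open>x\<close> is replaced by \<open>b - \<delta> *s a\<close>.\<close>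
  have prod: "a \<cdot> b = (\<delta> * (1 - \<gamma>)) *s a + \<gamma> *s b"
    if "b = \<delta> *s a + x" "x \<in> eigenspace \<gamma> a" for x \<gamma>
    using that aa by (simp add: eigenspace_iff mult_add_right mult_scale_right algebra_simps)
  from dim_two_eigenvectors[OF ax dim v w] show thesis
  proof
    assume "v = 0"
    with b have b': "b = \<delta> *s a + w" by simp
    then have "w \<noteq> 0" using nspan by (auto simp: span_singleton)
    then show thesis
      using that[of \<beta>] beta_eigenvector_coefficient[OF pa bb b' w] prod[OF b' w] by simp
  next
    assume "w = 0"
    with b have "b = \<delta> *s a + v" by simp
    then show thesis using that[of \<alpha>] prod v by simp
  qed
qed

text \<open>The line through an idempotent is already a subalgebra, so it would contain everything
  generated and the dimension would be at most 1.\<close>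

lemma generated_dim_two_not_in_span:
  assumes "a \<cdot> a = a" "generated {a, b} = UNIV" "dim (UNIV :: 'v set) = 2"
  shows "b \<notin> span {a}"
proof
  assume "b \<in> span {a}"
  moreover have "subalgebra (span {a})"
    unfolding subalgebra_def
  proof (intro conjI ballI)
    show "x \<cdot> y \<in> span {a}" if "x \<in> span {a}" "y \<in> span {a}" for x y
      using that assms(1) by (auto simp: span_singleton mult_scale_left mult_scale_right)
  qed simp
  ultimately have "generated {a, b} \<subseteq> span {a}"
    unfolding generated_def by (intro hull_minimal) (auto simp: span_base)
  then have "dim (UNIV :: 'v set) \<le> card {a}"
    using assms(2) by (intro dim_le_card) auto
  then show False using assms(3) by simp
qed

lemma independent_pair_eq:
  assumes "a \<noteq> 0" "b \<notin> span {a}" "p *s a + q *s b = r *s a + s *s b"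
  shows "p = r" "q = s"
proof -
  have eq: "(q - s) *s b = (r - p) *s a"
    using assms(3) by (simp add: algebra_simps)
  show "q = s"
  proof (rule ccontr)
    assume "q \<noteq> s"
    then have "b = (inverse (q - s) * (r - p)) *s a"
      using arg_cong[OF eq, of "scale (inverse (q - s))"] by simp
    then show False using assms(2) by (auto simp: span_singleton)
  qed
  then show "p = r" using eq assms(1) by simp
qed

end

theorem proposition4:
  fixes scale :: "'f::field \<Rightarrow> 'v::ab_group_add \<Rightarrow> 'v"
    and mult :: "'v \<Rightarrow> 'v \<Rightarrow> 'v"
    and \<alpha> \<beta> \<delta> :: 'f
    and a b b\<^sub>\<alpha> b\<^sub>\<beta> :: 'v
  assumes "comm_algebra scale mult"
    and "\<alpha> \<noteq> 1" and "\<beta> \<noteq> 1" and "\<alpha> \<noteq> \<beta>"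
    and "vector_space.dim scale (UNIV :: 'v set) = 2"
    and "comm_algebra.axial_algebra scale mult \<alpha> \<beta>"
    and "comm_algebra.star_condition scale mult \<alpha> \<beta>"
    and "comm_algebra.primitive_axis scale mult \<alpha> \<beta> a"
    and "comm_algebra.primitive_axis scale mult \<alpha> \<beta> b"
    and "comm_algebra.generated scale mult {a, b} = UNIV"
    and "b\<^sub>\<alpha> \<in> comm_algebra.eigenspace scale mult \<alpha> a"
    and "b\<^sub>\<beta> \<in> comm_algebra.eigenspace scale mult \<beta> a"
    and "b = scale \<delta> a + b\<^sub>\<alpha> + b\<^sub>\<beta>"
  shows "(mult a b = scale \<alpha> (a + b) \<and> \<delta> = - \<alpha> / (\<alpha> - 1)) \<or>
    (mult a b = scale \<beta> (a + b) \<and>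
      (\<beta> = - 1 \<or> ((2 :: 'f) \<noteq> 0 \<and> \<beta> = 1 / 2)) \<and>
      \<delta> = - \<beta> / (\<beta> - 1))"
proof -
  interpret comm_algebra scale mult by fact
  note pa = assms(8) and pb = assms(9)
  have axb: "axis \<alpha> \<beta> b" using pb by (simp add: primitive_axis_def)
  have ida: "a \<noteq> 0" "mult a a = a" and idb: "mult b b = b"
    using pa pb by (simp_all add: primitive_axis_def axis_def)
  have nb: "b \<notin> span {a}"
    using generated_dim_two_not_in_span ida(2) assms(5,10) by blast
  have na: "a \<notin> span {b}"
    using generated_dim_two_not_in_span[of b a] idb assms(5,10) by (simp add: insert_commute)
  obtain u v w where uvw: "u \<in> eigenspace 1 b" "v \<in> eigenspace \<alpha> b" "w \<in> eigenspace \<beta> b"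
    "a = u + v + w"
    using axis_decomposition[OF axb] by metis
  \<comment> \<open>The \<star>-condition gives \<open>u\<close> the same coefficient \<delta>, so
    the roles of \<open>a\<close> and \<open>b\<close> can be exchanged.\<close>
  have "proj1 \<alpha> \<beta> b a = scale \<delta> b"
    using assms(7,11-13) pa pb unfolding star_condition_def by blast
  then have a: "a = scale \<delta> b + v + w"
    using proj1_eq[OF axb uvw(1-3)] uvw(4) by simp
  obtain \<gamma> where g: "\<gamma> = \<alpha> \<or> \<gamma> = \<beta> \<and> 2 * \<delta> * \<beta> = 1"
    "mult a b = scale (\<delta> * (1 - \<gamma>)) a + scale \<gamma> b"
    using dim_two_product[OF pa assms(5) idb nb assms(11-13)] by metis
  obtain \<gamma>' where g': "\<gamma>' = \<alpha> \<or> \<gamma>' = \<beta> \<and> 2 * \<delta> * \<beta> = 1"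
    "mult b a = scale (\<delta> * (1 - \<gamma>')) b + scale \<gamma>' a"
    using dim_two_product[OF pb assms(5) ida(2) na uvw(2,3) a] by metis
  have "scale (\<delta> * (1 - \<gamma>)) a + scale \<gamma> b = scale \<gamma>' a + scale (\<delta> * (1 - \<gamma>')) b"
    using g(2) g'(2) mult_commute[of a b] by (simp add: add.commute)
  from independent_pair_eq[OF ida(1) nb this]
  have e: "\<delta> * (1 - \<gamma>) = \<gamma>'" "\<gamma> = \<delta> * (1 - \<gamma>')" .
  have "\<gamma> = \<gamma>'"
  proof (rule ccontr)
    assume ne: "\<gamma> \<noteq> \<gamma>'"
    \<comment> \<open>Subtracting the two relations in \<open>e\<close> isolates the factor \<delta>
      - 1.\<close>
    have "\<delta> * (\<gamma> - \<gamma>') = \<delta> * (1 - \<gamma>') - \<delta> * (1 - \<gamma>)"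
      by (simp add: algebra_simps)
    also have "\<dots> = \<gamma> - \<gamma>'" using e by simp
    finally have "(\<delta> - 1) * (\<gamma> - \<gamma>') = 0" by (simp add: left_diff_distrib)
    then have "\<delta> = 1" using ne by simp
    moreover have "\<gamma> + \<gamma>' = \<alpha> + \<beta>" "2 * \<delta> * \<beta> = 1"
      using g(1) g'(1) ne by auto
    \<comment> \<open>With \<delta> = 1, \<open>e\<close> gives \<alpha> + \<beta> = 1 = 2 \<beta>;
      no division by 2 occurs, so the characteristic is irrelevant.\<close>
    ultimately have "\<alpha> = \<beta>" using e by algebra
    then show False using assms(4) by simp
  qed
  then have d: "\<delta> * (1 - \<gamma>) = \<gamma>" and prod: "mult a b = scale \<gamma> (a + b)"
    using e g(2) by (simp_all add: scale_right_distrib)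
  have "\<gamma> \<noteq> 1" using g(1) assms(2,3) by auto
  then have del: "\<delta> = - \<gamma> / (\<gamma> - 1)"
    using d nonzero_eq_divide_eq[of "\<gamma> - 1" \<delta> "- \<gamma>"] minus_mult_right[of \<delta> "1 - \<gamma>"]
    by simp
  from g(1) show ?thesis
  proof
    assume "\<gamma> = \<alpha>"
    then show ?thesis using prod del by simp
  next
    assume *: "\<gamma> = \<beta> \<and> 2 * \<delta> * \<beta> = 1"
    then have "(2::'f) \<noteq> 0" by auto
    \<comment> \<open>Multiplying \<open>d\<close> by 2 \<beta> eliminates \<delta> and leaves a
      quadratic in \<beta> with factors \<beta> + 1 and 2 \<beta> - 1.\<close>
    have "2 * \<beta> * \<beta> = 2 * \<beta> * (\<delta> * (1 - \<beta>))" using d * by simp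
    also have "\<dots> = (2 * \<delta> * \<beta>) * (1 - \<beta>)" by (simp only: mult_ac)
    also have "\<dots> = 1 - \<beta>" using * by simp
    finally have "2 * \<beta> * \<beta> = 1 - \<beta>" .
    moreover have "(\<beta> + 1) * (2 * \<beta> - 1) = 2 * \<beta> * \<beta> + \<beta> - 1" by algebra
    ultimately have "(\<beta> + 1) * (2 * \<beta> - 1) = 0" by simp
    then have "\<beta> + 1 = 0 \<or> \<beta> * 2 = 1" by (simp add: mult.commute)
    then have "\<beta> = - 1 \<or> (2::'f) \<noteq> 0 \<and> \<beta> = 1 / 2"
      using \<open>(2::'f) \<noteq> 0\<close> nonzero_eq_divide_eq[of 2 \<beta> 1] eq_neg_iff_add_eq_0[of \<beta> 1]
      by metis
    then show ?thesis using prod del * by simp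
  qed
qed

end
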